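(* For every integer $k\ge 6$, there exist infinitely many pairwise non-isomorphic $k$-graphs $(X,\mathscr{M})$ such that (1) $(X,\mathscr{M})$ is asymmetric, and (2) every sub-$k$-graph $(X',\mathscr{M}')$ of $(X,\mathscr{M})$ with $2\le |X'|<|X|$ has an involution.
   Context: A $k$-graph is a pair $(X,\mathscr{M})$ with $X$ a finite set and $\mathscr{M}\subseteq\binom{X}{k}$. An automorphism is a bijection $\phi:X\to X$ with $\{\phi(M):M\in\mathscr{M}\}=\mathscr{M}$. A $k$-graph is asymmetric if its only automorphism is the identity. An involution is a non-identity automorphism $\phi$ with $\phi\circ\phi$ equal to the identity. A sub-$k$-graph of $(X,\mathscr{M})$ is a $k$-graph $(X',\mathscr{M}')$ with $X'\subseteq X$ and $\mathscr{M}'\subseteq\mathscr{M}$ (not necessarily induced). *)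

theory Defs
  imports "HOL-Library.Ramsey"
begin

(* nsets X k, written [X]^k with a superscript, is the set of all k-element
   subsets of X. *)
definition kgraph :: "nat \<Rightarrow> 'a set \<Rightarrow> 'a set set \<Rightarrow> bool" where
  "kgraph k X M \<longleftrightarrow> finite X \<and> M \<subseteq> nsets X k"

(* Maps are total HOL functions; their values outside the vertex set are irrelevant. *)
definition isomorphism ::
    "('a \<Rightarrow> 'b) \<Rightarrow> 'a set \<Rightarrow> 'a set set \<Rightarrow> 'b set \<Rightarrow> 'b set set \<Rightarrow> bool" where
  "isomorphism f X M Y N \<longleftrightarrow> bij_betw f X Y \<and> {f ` E |E. E \<in> M} = N"

definition isomorphic :: "'a set \<times> 'a set set \<Rightarrow> 'b set \<times> 'b set set \<Rightarrow> bool" where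
  "isomorphic = (\<lambda>(X, M) (Y, N). \<exists>f. isomorphism f X M Y N)"

definition automorphism :: "('a \<Rightarrow> 'a) \<Rightarrow> 'a set \<Rightarrow> 'a set set \<Rightarrow> bool" where
  "automorphism \<phi> X M \<longleftrightarrow> bij_betw \<phi> X X \<and> {\<phi> ` E |E. E \<in> M} = M"

definition asymmetric :: "'a set \<Rightarrow> 'a set set \<Rightarrow> bool" where
  "asymmetric X M \<longleftrightarrow> (\<forall>\<phi>. automorphism \<phi> X M \<longrightarrow> (\<forall>x\<in>X. \<phi> x = x))"

definition involution :: "('a \<Rightarrow> 'a) \<Rightarrow> 'a set \<Rightarrow> 'a set set \<Rightarrow> bool" where
  "involution \<phi> X M \<longleftrightarrow>
     automorphism \<phi> X M \<and> (\<exists>x\<in>X. \<phi> x \<noteq> x) \<and> (\<forall>x\<in>X. \<phi> (\<phi> x) = x)"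

definition sub_kgraph :: "nat \<Rightarrow> 'a set \<Rightarrow> 'a set set \<Rightarrow> 'a set \<Rightarrow> 'a set set \<Rightarrow> bool" where
  "sub_kgraph k X' M' X M \<longleftrightarrow> kgraph k X' M' \<and> X' \<subseteq> X \<and> M' \<subseteq> M"

end

theory Submission
  imports Defs "HOL-Library.Nat_Bijection"
begin

text \<open>
  Work dually: a vertex is identified with its star, the set of (indices of) edges containing it, so
  a \<open>k\<close>-graph with edges indexed by \<open>{..<n}\<close> is a family of subsets of \<open>{..<n}\<close> covering each index
  exactly \<open>k\<close> times. The family consists of all singletons \<open>{i}\<close>, all cyclic pairs \<open>{i, i + 1}\<close>, and
  \<open>k - 3\<close> bipartitions of \<open>{..<n}\<close> with pairwise distinct part sizes, all at least 3.

  Once edge \<open>i\<close> is dropped, the vertices with stars \<open>{i + 1}\<close> and \<open>{i, i + 1}\<close> become twins, and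
  swapping them is an involution unless edge \<open>i + 1\<close> is dropped too; running around the cycle, either
  no edge or every edge is dropped. An automorphism permutes the indices, preserving the cycle formed
  by the stars of size 2, and fixes the only star of size 3, which is chosen to be \<open>{0, 1, 3}\<close>; this
  set has no symmetry in the cycle.
\<close>

section \<open>Dual construction: stars, vertices and edges\<close>

definition block :: "nat \<Rightarrow> nat set" where
  "block j = (if j = 3 then {0, 1, 3} else {..<j})"

definition stars :: "nat \<Rightarrow> nat \<Rightarrow> nat set set" where
  "stars k n = (\<lambda>i. {i}) ` {..<n} \<union> (\<lambda>i. {i, Suc i mod n}) ` {..<n} \<union>
     block ` {3..<k} \<union> (\<lambda>j. {..<n} - block j) ` {3..<k}"

text \<open>Encoding stars as numbers puts the graphs for all \<open>n\<close> on the one vertex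
  type \<open>nat\<close>.\<close>

definition vertices :: "nat \<Rightarrow> nat \<Rightarrow> nat set" where
  "vertices k n = set_encode ` stars k n"

definition edge :: "nat \<Rightarrow> nat \<Rightarrow> nat \<Rightarrow> nat set" where
  "edge k n i = {v \<in> vertices k n. i \<in> set_decode v}"

definition edges :: "nat \<Rightarrow> nat \<Rightarrow> nat set set" where
  "edges k n = edge k n ` {..<n}"

lemma stars_cases:
  assumes "s \<in> stars k n"
  obtains (singleton) i where "i < n" "s = {i}"
    | (pair) i where "i < n" "s = {i, Suc i mod n}"
    | (block) j where "3 \<le> j" "j < k" "s = block j"
    | (compl) j where "3 \<le> j" "j < k" "s = {..<n} - block j"
  using assms unfolding stars_def by fastforce

lemma card_block [simp]: "card (block j) = j"
  by (simp add: block_def)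

lemma block_subset: "3 \<le> j \<Longrightarrow> j < n \<Longrightarrow> block j \<subseteq> {..<n}"
  by (auto simp: block_def)

lemma finite_block [simp]: "finite (block j)"
  by (simp add: block_def)

lemma card_block_compl:
  assumes "3 \<le> j" "j < n"
  shows "card ({..<n} - block j) = n - j"
  using block_subset[OF assms] by (simp add: card_Diff_subset)

lemma stars_subset:
  assumes "k \<le> n" "s \<in> stars k n"
  shows "s \<subseteq> {..<n}"
  using assms(2)
proof (cases rule: stars_cases)
  case (block j)
  then show ?thesis using block_subset[of j n] assms(1) by simp
qed auto

text \<open>\<open>set_decode\<close> inverts \<open>set_encode\<close> only on finite sets, so each
  passage between stars and vertices relies on this.\<close>

lemma finite_star: "k \<le> n \<Longrightarrow> s \<in> stars k n \<Longrightarrow> finite s"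
  by (rule finite_subset[OF stars_subset finite_lessThan])

lemma decode_vertex:
  assumes "k \<le> n" "v \<in> vertices k n"
  shows "set_decode v \<in> stars k n"
  using assms finite_star by (auto simp: vertices_def)

lemma encode_star: "s \<in> stars k n \<Longrightarrow> set_encode s \<in> vertices k n"
  by (simp add: vertices_def)

lemma finite_vertices: "finite (vertices k n)"
  by (simp add: vertices_def stars_def)

lemma encode_in_edge:
  assumes "k \<le> n" "s \<in> stars k n"
  shows "set_encode s \<in> edge k n i \<longleftrightarrow> i \<in> s"
  using assms finite_star by (auto simp: edge_def encode_star)

lemma singleton_star: "i < n \<Longrightarrow> {i} \<in> stars k n"
  by (auto simp: stars_def)

lemma pair_star: "i < n \<Longrightarrow> {i, Suc i mod n} \<in> stars k n"
  by (auto simp: stars_def)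

text \<open>The singleton stars separate the edges: the vertex with star \<open>{i}\<close> lies in
  edge \<open>i\<close> and in no other.\<close>

lemma edge_inj:
  assumes "k \<le> n" "i < n" "edge k n i = edge k n j"
  shows "i = j"
proof -
  have "set_encode {i} \<in> edge k n i"
    using encode_in_edge[OF assms(1) singleton_star[OF assms(2)]] by blast
  then have "set_encode {i} \<in> edge k n j"
    using assms(3) by simp
  then show ?thesis
    using encode_in_edge[OF assms(1) singleton_star[OF assms(2)]] by simp
qed

lemma card_edges: "k \<le> n \<Longrightarrow> card (edges k n) = n"
  using edge_inj[of k n] by (simp add: edges_def card_image inj_on_def)

section \<open>Uniformity of the hypergraph\<close>

lemma Suc_mod_eq: "i < n \<Longrightarrow> Suc i mod n = (if Suc i = n then 0 else Suc i)"
  by auto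

text \<open>With \<open>h\<close> the cyclic predecessor of \<open>i\<close>, only two cyclic pairs
  meet \<open>i\<close>, and each bipartition has exactly one part containing
  \<open>i\<close>.\<close>

lemma stars_containing:
  assumes "2 * k \<le> n" "i < n" "h < n" "Suc h mod n = i"
  shows "{s \<in> stars k n. i \<in> s} =
    {{i}, {i, Suc i mod n}, {h, i}} \<union>
    (\<lambda>j. if i \<in> block j then block j else {..<n} - block j) ` {3..<k}"
    (is "?L = ?R")
proof
  have uniq: "j = h" if "j < n" "Suc j mod n = i" for j
    using that assms by (auto simp: Suc_mod_eq split: if_splits)
  show "?L \<subseteq> ?R"
  proof
    fix s assume "s \<in> ?L"
    then have "i \<in> s" and "s \<in> stars k n" by auto
    from this(2) show "s \<in> ?R"
    proof (cases rule: stars_cases)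
      case (pair j)
      then show ?thesis using uniq[of j] \<open>i \<in> s\<close> assms(4) by blast
    qed (use \<open>i \<in> s\<close> in auto)
  qed
  have "{h, i} \<in> stars k n"
    using pair_star[of h n k] assms by simp
  moreover have "block j \<in> stars k n" "{..<n} - block j \<in> stars k n" if "j \<in> {3..<k}" for j
    using that by (simp_all add: stars_def)
  ultimately show "?R \<subseteq> ?L"
    using singleton_star[OF assms(2), of k] pair_star[OF assms(2), of k] assms(2) by auto
qed

text \<open>The count is 1 + 2 + (k - 3): one singleton, two cyclic pairs, and one part from each
  bipartition.\<close>

lemma card_stars_containing:
  assumes "4 \<le> k" "2 * k \<le> n" "i < n"
  shows "card {s \<in> stars k n. i \<in> s} = k"
proof -
  define f where "f j = (if i \<in> block j then block j else {..<n} - block j)" for j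
  have cf: "card (f j) = j \<or> card (f j) = n - j" if "j \<in> {3..<k}" for j
    using card_block_compl[of j n] that assms by (simp add: f_def)
  have big: "3 \<le> card (f j)" if "j \<in> {3..<k}" for j
    using cf[OF that] that assms by auto
  \<comment> \<open>Sizes tell the parts apart: \<open>j < k < n - j\<close> for all
    \<open>j\<close> in the range because \<open>2 * k \<le> n\<close>, so the size of
    \<open>f j\<close> determines \<open>j\<close>.\<close>
  have "inj_on f {3..<k}"
  proof (rule inj_onI)
    fix a b assume "a \<in> {3..<k}" "b \<in> {3..<k}" "f a = f b"
    then show "a = b"
      using cf[of a] cf[of b] assms by auto
  qed
  then have cardf: "card (f ` {3..<k}) = k - 3"
    by (simp add: card_image)
  obtain h where h: "h < n" "Suc h mod n = i"
    using assms by (cases i) (auto intro: that[of "n - 1"] that[of "i - 1"])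
  let ?P = "{{i}, {i, Suc i mod n}, {h, i}}"
  have "Suc i mod n \<noteq> i" "h \<noteq> i" "Suc i mod n \<noteq> h"
    using assms h by (auto simp: Suc_mod_eq split: if_splits)
  then have cardP: "card ?P = 3"
    by (simp add: doubleton_eq_iff)
  have small: "card s \<le> 2" if "s \<in> ?P" for s
    using that by (auto simp: card_insert_if)
  have "?P \<inter> f ` {3..<k} = {}"
  proof (rule equals0I)
    fix s assume "s \<in> ?P \<inter> f ` {3..<k}"
    then obtain j where "s \<in> ?P" "j \<in> {3..<k}" "s = f j" by blast
    then show False using small[of s] big[of j] by simp
  qed
  then have "card (?P \<union> f ` {3..<k}) = k"
    using card_Un_disjoint[of ?P "f ` {3..<k}"] cardf cardP assms by simp
  then show ?thesis
    unfolding stars_containing[OF assms(2,3) h] f_def .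
qed

lemma edge_eq_image: "k \<le> n \<Longrightarrow> edge k n i = set_encode ` {s \<in> stars k n. i \<in> s}"
  by (auto simp: edge_def vertices_def finite_star)

lemma inj_on_encode_stars: "k \<le> n \<Longrightarrow> inj_on set_encode (stars k n)"
  using finite_star by (intro inj_on_subset[OF inj_on_set_encode] subsetI) simp

lemma kgraph_vertices_edges:
  assumes "4 \<le> k" "2 * k \<le> n"
  shows "kgraph k (vertices k n) (edges k n)"
proof -
  have "card (edge k n i) = k" if "i < n" for i
  proof -
    have "inj_on set_encode {s \<in> stars k n. i \<in> s}"
      by (rule inj_on_subset[OF inj_on_encode_stars[of k n]]) (use assms in auto)
    then show ?thesis
      using card_stars_containing[OF assms that] assms by (simp add: edge_eq_image card_image)
  qed
  moreover have "edge k n i \<subseteq> vertices k n" "finite (edge k n i)" for i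
    using finite_vertices[of k n] by (simp_all add: edge_def)
  ultimately have "edges k n \<subseteq> nsets (vertices k n) k"
    unfolding edges_def nsets_def by blast
  then show ?thesis
    using finite_vertices unfolding kgraph_def by blast
qed

section \<open>Rigidity of the star family and asymmetry\<close>

lemma card_2_star:
  assumes "4 \<le> k" "2 * k \<le> n" "s \<in> stars k n" "card s = 2"
  obtains i where "i < n" "s = {i, Suc i mod n}"
  using assms(3)
proof (cases rule: stars_cases)
  case (singleton i)
  then show ?thesis using assms(4) by simp
next
  case (pair i)
  then show ?thesis by (rule that)
next
  case (block j)
  then show ?thesis using assms(4) by simp
next
  case (compl j)
  then show ?thesis using assms card_block_compl[of j n] by simp
qed

text \<open>Complements of blocks have more than \<open>k\<close> elements, which leaves
  \<open>block 3\<close>. Index permutations preserve sizes, so any that preserves the stars must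
  map this set onto itself.\<close>

lemma card_3_star:
  assumes "4 \<le> k" "2 * k \<le> n" "s \<in> stars k n" "card s = 3"
  shows "s = {0, 1, 3}"
  using assms(3)
proof (cases rule: stars_cases)
  case (pair i)
  then show ?thesis using assms(4) by (auto simp: card_insert_if split: if_splits)
next
  case (block j)
  then have "j = 3" using assms(4) by simp
  then show ?thesis using block by (simp add: block_def)
next
  case (compl j)
  then show ?thesis using assms card_block_compl[of j n] by simp
qed (use assms(4) in simp)

text \<open>This is adjacency in the n-cycle, with the wrap-around at 0 and \<open>n - 1\<close>
  written out to allow plain arithmetic.\<close>

lemma doubleton_star_iff:
  assumes "4 \<le> k" "2 * k \<le> n" "a < n" "b < n" "a \<noteq> b"
  shows "{a, b} \<in> stars k n \<longleftrightarrow>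
    b = Suc a \<or> a = Suc b \<or> a = 0 \<and> Suc b = n \<or> b = 0 \<and> Suc a = n"
proof
  assume "{a, b} \<in> stars k n"
  then obtain i where "i < n" "{a, b} = {i, Suc i mod n}"
    using card_2_star[OF assms(1,2)] assms(5) by (metis card_2_iff)
  then show "b = Suc a \<or> a = Suc b \<or> a = 0 \<and> Suc b = n \<or> b = 0 \<and> Suc a = n"
    by (cases "Suc i = n") (auto simp: doubleton_eq_iff)
next
  assume "b = Suc a \<or> a = Suc b \<or> a = 0 \<and> Suc b = n \<or> b = 0 \<and> Suc a = n"
  then show "{a, b} \<in> stars k n"
    using pair_star[OF assms(3), of k] pair_star[OF assms(4), of k] assms
    by (auto simp: insert_commute)
qed

lemma stars_rigid:
  assumes k: "4 \<le> k" "2 * k \<le> n"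
    and bij: "bij_betw p {..<n} {..<n}"
    and S: "\<And>s. s \<in> stars k n \<Longrightarrow> p ` s \<in> stars k n"
    and "i < n"
  shows "p i = i"
proof -
  have lt: "p a < n" if "a < n" for a
    using bij that by (auto simp: bij_betw_def)
  have inj: "p a \<noteq> p b" if "a < n" "b < n" "a \<noteq> b" for a b
    using bij that by (auto simp: bij_betw_def inj_on_def)
  have adj: "p (Suc a) = Suc (p a) \<or> p a = Suc (p (Suc a)) \<or>
      p a = 0 \<and> Suc (p (Suc a)) = n \<or> p (Suc a) = 0 \<and> Suc (p a) = n"
    if "Suc a < n" for a
  proof -
    have "{p a, p (Suc a)} \<in> stars k n"
      using S[OF pair_star[of a n k]] that by simp
    then show ?thesis
      using doubleton_star_iff[OF k] lt inj that by simp
  qed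
  have "block 3 \<in> stars k n"
    using k by (auto simp: stars_def)
  then have "p ` {0, 1, 3} \<in> stars k n"
    using S[of "block 3"] by (simp add: block_def)
  moreover have "card (p ` {0, 1, 3}) = 3"
    using inj k by (subst card_image) (auto simp: inj_on_def)
  ultimately have A: "p ` {0, 1, 3} = {0, 1, 3}"
    by (rule card_3_star[OF k])
  have "p x \<in> {0, 1, 3}" if "x \<in> {0, 1, 3}" for x
    using A imageI[OF that, of p] by simp
  then have mem: "p 0 \<in> {0, 1, 3}" "p 1 \<in> {0, 1, 3}" "p 3 \<in> {0, 1, 3}"
    by simp_all
  have "p 0 \<noteq> p 1" "p 0 \<noteq> p 3" "p 1 \<noteq> p 3"
    using inj[of 0 1] inj[of 0 3] inj[of 1 3] k by simp_all
  moreover have n: "n \<ge> 8" using k by simp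
  moreover have "p 1 = Suc (p 0) \<or> p 0 = Suc (p 1) \<or> p 0 = 0 \<and> Suc (p 1) = n \<or> p 1 = 0 \<and> Suc (p 0) = n"
    using adj[of 0] n by simp
  \<comment> \<open>Since \<open>n \<ge> 8\<close>, 0 and 1 are the only adjacent pair in
    \<open>{0, 1, 3}\<close>. So \<open>p\<close> fixes 3 and either fixes or swaps 0 and 1.\<close>
  ultimately have p01: "p 0 = 0 \<and> p 1 = 1 \<and> p 3 = 3 \<or> p 0 = 1 \<and> p 1 = 0 \<and> p 3 = 3"
    using mem by (elim insertE emptyE) simp_all
  \<comment> \<open>Index 2 rules out the swap: \<open>p 2\<close> would be a common neighbour of 0
    and 3, and these have none when \<open>n \<ge> 8\<close>.\<close>
  have "p 2 = Suc (p 1) \<or> p 1 = Suc (p 2) \<or> p 1 = 0 \<and> Suc (p 2) = n \<or> p 2 = 0 \<and> Suc (p 1) = n"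
    using adj[of 1] n by (simp add: numeral_2_eq_2)
  moreover have "p 3 = Suc (p 2) \<or> p 2 = Suc (p 3) \<or> p 2 = 0 \<and> Suc (p 3) = n \<or> p 3 = 0 \<and> Suc (p 2) = n"
    using adj[of 2] n by (simp add: numeral_3_eq_3 numeral_2_eq_2)
  moreover have "p 2 \<noteq> p 0" using inj[of 2 0] n by simp
  ultimately have base: "p 0 = 0 \<and> p 1 = 1"
    using p01 n by (elim disjE conjE) simp_all
  \<comment> \<open>Two consecutive fixed points propagate: \<open>p (m + 2)\<close> is a neighbour
    of \<open>m + 1\<close> other than \<open>m\<close>.\<close>
  have "Suc m < n \<longrightarrow> p m = m \<and> p (Suc m) = Suc m" for m
  proof (induction m)
    case 0
    then show ?case using base by simp
  next
    case (Suc m)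
    show ?case
    proof
      assume m: "Suc (Suc m) < n"
      then have "p (Suc m) = Suc m" "p (Suc (Suc m)) \<noteq> m" "p (Suc (Suc m)) \<noteq> 0"
        using Suc inj[of m "Suc (Suc m)"] inj[of 0 "Suc (Suc m)"] base by auto
      then show "p (Suc m) = Suc m \<and> p (Suc (Suc m)) = Suc (Suc m)"
        using adj[OF m] by auto
    qed
  qed
  then show ?thesis
    using \<open>i < n\<close> base by (cases i) auto
qed

text \<open>An automorphism induces an index permutation \<open>p\<close> that carries the star of
  each vertex to the star of its image. Rigidity makes \<open>p\<close> the identity, so all stars
  are fixed, and a vertex is recovered from its star.\<close>

lemma asymmetric_vertices_edges:
  assumes k: "4 \<le> k" "2 * k \<le> n"
  shows "asymmetric (vertices k n) (edges k n)"
  unfolding asymmetric_def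
proof (intro allI impI ballI)
  fix \<phi> v
  assume aut: "automorphism \<phi> (vertices k n) (edges k n)" and v: "v \<in> vertices k n"
  have kn: "k \<le> n" using k by simp
  have bij: "bij_betw \<phi> (vertices k n) (vertices k n)"
    using aut by (simp add: automorphism_def)
  have sub: "edge k n i \<subseteq> vertices k n" for i
    by (auto simp: edge_def)
  have "\<exists>j<n. \<phi> ` edge k n i = edge k n j" if "i < n" for i
  proof -
    have "\<phi> ` edge k n i \<in> edges k n"
      using aut that unfolding automorphism_def edges_def by blast
    then show ?thesis by (auto simp: edges_def)
  qed
  then obtain p where p: "\<And>i. i < n \<Longrightarrow> p i < n \<and> \<phi> ` edge k n i = edge k n (p i)"
    by metis
  have "inj_on p {..<n}"
  proof (rule inj_onI)
    fix i j assume "i \<in> {..<n}" "j \<in> {..<n}" "p i = p j"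
    then have "\<phi> ` edge k n i = \<phi> ` edge k n j"
      using p by simp
    then have "edge k n i = edge k n j"
      using inj_on_image_eq_iff[of \<phi> "vertices k n"] bij sub by (auto simp: bij_betw_def)
    then show "i = j"
      using edge_inj kn \<open>i \<in> {..<n}\<close> by blast
  qed
  moreover have "p ` {..<n} \<subseteq> {..<n}"
    using p by auto
  ultimately have pbij: "bij_betw p {..<n} {..<n}"
    by (simp add: bij_betw_def endo_inj_surj)
  have star: "set_decode (\<phi> w) = p ` set_decode w" if w: "w \<in> vertices k n" for w
  proof -
    have \<phi>w: "\<phi> w \<in> vertices k n"
      using bij w by (auto simp: bij_betw_def)
    have iff: "p i \<in> set_decode (\<phi> w) \<longleftrightarrow> i \<in> set_decode w" if "i < n" for i
    proof -
      have "p i \<in> set_decode (\<phi> w) \<longleftrightarrow> \<phi> w \<in> \<phi> ` edge k n i"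
        using p[OF that] \<phi>w by (simp add: edge_def)
      also have "\<dots> \<longleftrightarrow> w \<in> edge k n i"
        using inj_on_image_mem_iff[of \<phi> "vertices k n"] bij w sub by (auto simp: bij_betw_def)
      finally show ?thesis
        using w by (simp add: edge_def)
    qed
    have sub_n: "set_decode w \<subseteq> {..<n}" "set_decode (\<phi> w) \<subseteq> {..<n}"
      using stars_subset[OF kn] decode_vertex[OF kn] w \<phi>w by auto
    show ?thesis
    proof
      show "p ` set_decode w \<subseteq> set_decode (\<phi> w)"
        using iff sub_n(1) by (meson image_subsetI lessThan_iff subset_iff)
      show "set_decode (\<phi> w) \<subseteq> p ` set_decode w"
      proof
        fix j assume j: "j \<in> set_decode (\<phi> w)"
        then obtain i where "i < n" "j = p i"
          using sub_n(2) pbij by (metis bij_betw_imp_surj_on imageE lessThan_iff subsetD)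
        then show "j \<in> p ` set_decode w"
          using iff j by simp
      qed
    qed
  qed
  have "p ` s \<in> stars k n" if "s \<in> stars k n" for s
  proof -
    have "\<phi> (set_encode s) \<in> vertices k n"
      using bij encode_star[OF that] by (auto simp: bij_betw_def)
    moreover have "set_decode (\<phi> (set_encode s)) = p ` s"
      using star[OF encode_star[OF that]] finite_star[OF kn that] by simp
    ultimately show ?thesis
      using decode_vertex[OF kn] by metis
  qed
  then have fix_index: "p i = i" if "i < n" for i
    using stars_rigid[OF k pbij] that by blast
  have "p i = i" if "i \<in> set_decode v" for i
    using fix_index stars_subset[OF kn decode_vertex[OF kn v]] that by blast
  then have "set_decode (\<phi> v) = set_decode v"
    using star[OF v] by simp
  then have "set_encode (set_decode (\<phi> v)) = set_encode (set_decode v)"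
    by (rule arg_cong)
  then show "\<phi> v = v"
    by simp
qed

section \<open>Involutions of proper sub-hypergraphs\<close>

lemma ex_involution_twins:
  assumes "a \<in> X" "b \<in> X" "a \<noteq> b" "\<And>E. E \<in> M \<Longrightarrow> a \<in> E \<longleftrightarrow> b \<in> E"
  shows "\<exists>\<phi>. involution \<phi> X M"
proof -
  \<comment> \<open>The transposition of the twins \<open>a\<close> and \<open>b\<close> maps each
    edge onto itself.\<close>
  define f where "f v = (if v = a then b else if v = b then a else v)" for v
  have f_f: "f (f v) = v" for v
    by (simp add: f_def)
  have image: "f ` E = E" if "a \<in> E \<longleftrightarrow> b \<in> E" for E
  proof -
    have closed: "f v \<in> E" if "v \<in> E" for v
      using that \<open>a \<in> E \<longleftrightarrow> b \<in> E\<close> by (metis f_def)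
    show ?thesis
    proof
      show "f ` E \<subseteq> E"
        using closed by (rule image_subsetI)
      show "E \<subseteq> f ` E"
      proof
        fix v assume "v \<in> E"
        then have "f (f v) \<in> f ` E" by (intro imageI closed)
        then show "v \<in> f ` E" by (simp only: f_f)
      qed
    qed
  qed
  have "inj_on f X"
    using f_f by (intro inj_on_inverseI)
  then have "bij_betw f X X"
    using image[of X] assms(1,2) by (simp add: bij_betw_def)
  moreover have "{f ` E |E. E \<in> M} = (\<lambda>E. f ` E) ` M"
    by (rule Setcompr_eq_image)
  moreover have "(\<lambda>E. f ` E) ` M = (\<lambda>E. E) ` M"
    using image assms(4) by (intro image_cong) simp_all
  moreover have "f a \<noteq> a"
    using assms(3) by (simp add: f_def)
  ultimately show ?thesis
    using assms(1) f_f unfolding involution_def automorphism_def by auto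
qed

text \<open>Used in contrapositive form: a property that holds at some indices but not at all of
  them is lost at some step \<open>i\<close> to \<open>Suc i mod n\<close>.\<close>

lemma cyclic_closed:
  assumes closed: "\<And>i. i < n \<Longrightarrow> P i \<Longrightarrow> P (Suc i mod n)"
    and "b < n" "P b" "i < n"
  shows "P i"
proof -
  have "P ((b + m) mod n)" for m
  proof (induction m)
    case 0
    then show ?case using assms by simp
  next
    case (Suc m)
    then show ?case using closed[of "(b + m) mod n"] \<open>b < n\<close> by (simp add: mod_Suc_eq)
  qed
  \<comment> \<open>The walk from \<open>b\<close> to \<open>i\<close> is lengthened by a full turn
    \<open>n\<close>, so the subtraction of \<open>b\<close> does not truncate.\<close>
  moreover have "b + (i + n - b) = i + n"
    using \<open>b < n\<close> by simp
  ultimately have "P ((i + n) mod n)"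
    by metis
  then show ?thesis
    using \<open>i < n\<close> by simp
qed

lemma sub_kgraph_involution:
  assumes k: "4 \<le> k" "2 * k \<le> n"
    and sub: "sub_kgraph k X' M' (vertices k n) (edges k n)"
    and card: "2 \<le> card X'" "card X' < card (vertices k n)"
  shows "\<exists>\<phi>. involution \<phi> X' M'"
proof (cases "M' = {}")
  case True
  \<comment> \<open>Without edges any two vertices are twins. An infinite set has
    \<open>card\<close> 0, so the lower bound also gives finiteness of \<open>X'\<close>.\<close>
  obtain a b where "a \<in> X'" "b \<in> X'" "a \<noteq> b"
    using card(1) card_le_Suc0_iff_eq[of X'] card.infinite[of X'] by fastforce
  then show ?thesis
    using ex_involution_twins[of a X' b M'] True by blast
next
  case False
  have kn: "k \<le> n" using k by simp
  have M': "M' \<subseteq> edges k n" "\<Union> M' \<subseteq> X'" "X' \<subseteq> vertices k n"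
    using sub by (auto simp: sub_kgraph_def kgraph_def nsets_def)
  obtain c where c: "c < n" "edge k n c \<in> M'"
    using False M'(1) by (auto simp: edges_def)
  \<comment> \<open>Every star is nonempty, so the edges together cover all vertices; keeping them
    all would force \<open>X'\<close> to be the whole vertex set.\<close>
  have "\<exists>b<n. edge k n b \<notin> M'"
  proof (rule ccontr)
    assume *: "\<not> (\<exists>b<n. edge k n b \<notin> M')"
    have "v \<in> X'" if v: "v \<in> vertices k n" for v
    proof -
      have s: "set_decode v \<in> stars k n"
        using decode_vertex[OF kn v] .
      have "set_decode v \<noteq> {}"
      proof
        assume "set_decode v = {}"
        with s show False
        proof (cases rule: stars_cases)
          case (block j)
          then show False using card_block[of j] \<open>set_decode v = {}\<close> by simp
        next
          case (compl j)
          then have "card (set_decode v) = n - j"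
            unfolding compl(3) using k by (intro card_block_compl) simp_all
          then show False using \<open>set_decode v = {}\<close> compl(2) k by simp
        qed auto
      qed
      then obtain i where "i \<in> set_decode v" by auto
      moreover then have "i < n" using stars_subset[OF kn s] by auto
      ultimately show ?thesis
        using * M'(2) v by (auto simp: edge_def)
    qed
    then have "X' = vertices k n"
      using M'(3) by auto
    then show False using card by simp
  qed
  then obtain b where "b < n" "edge k n b \<notin> M'" by auto
  then obtain i where i: "i < n" "edge k n i \<notin> M'" "edge k n (Suc i mod n) \<in> M'"
    using cyclic_closed[of n "\<lambda>i. edge k n i \<notin> M'" b c] c by blast
  \<comment> \<open>These stars differ only in \<open>i\<close>, whose edge is missing, so their
    vertices are twins; both lie in \<open>X'\<close> because the next edge is present.\<close>
  define x y where "x = {Suc i mod n}" and "y = {i, Suc i mod n}"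
  have S: "x \<in> stars k n" "y \<in> stars k n"
    using singleton_star[of "Suc i mod n" n k] pair_star[of i n k] i by (auto simp: x_def y_def)
  have "set_encode x \<in> X'" "set_encode y \<in> X'"
    using encode_in_edge[OF kn S(1), of "Suc i mod n"] encode_in_edge[OF kn S(2), of "Suc i mod n"]
      i(3) M'(2) by (auto simp: x_def y_def)
  moreover have "set_encode x \<noteq> set_encode y"
  proof -
    have "Suc i mod n \<noteq> i" using i k by (simp add: Suc_mod_eq)
    then have "x \<noteq> y" by (auto simp: x_def y_def)
    then show ?thesis using inj_on_encode_stars[OF kn] S by (auto simp: inj_on_def)
  qed
  moreover have "set_encode x \<in> E \<longleftrightarrow> set_encode y \<in> E" if E: "E \<in> M'" for E
  proof -
    have "E \<in> edges k n" using M'(1) E by blast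
    then obtain j where j: "E = edge k n j" by (auto simp: edges_def)
    then have "j \<noteq> i" using E i by auto
    then show ?thesis
      unfolding j encode_in_edge[OF kn S(1)] encode_in_edge[OF kn S(2)] by (simp add: x_def y_def)
  qed
  ultimately show ?thesis
    by (rule ex_involution_twins)
qed

section \<open>Non-isomorphism by edge count, and the infinite family\<close>

lemma isomorphic_card_edges:
  assumes "isomorphic (X, M) (Y, N)" "\<Union> M \<subseteq> X"
  shows "card M = card N"
proof -
  obtain f where f: "inj_on f X" "(`) f ` M = N"
    using assms(1) by (auto simp: isomorphic_def isomorphism_def bij_betw_def)
  \<comment> \<open>All edges lie inside \<open>X\<close>, where \<open>f\<close> is injective, so
    distinct edges have distinct images.\<close>
  have "inj_on ((`) f) M"
  proof (rule inj_onI)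
    fix E F assume "E \<in> M" "F \<in> M" "f ` E = f ` F"
    moreover then have "E \<subseteq> X" "F \<subseteq> X" using assms(2) by auto
    ultimately show "E = F" using inj_on_image_eq_iff[OF f(1)] by simp
  qed
  from card_image[OF this] show ?thesis
    using f(2) by simp
qed

theorem theorem5:
  fixes k :: nat
  assumes "k \<ge> 6"
  shows "\<exists>\<G> :: (nat set \<times> nat set set) set.
    infinite \<G> \<and>
    pairwise (\<lambda>G H. \<not> isomorphic G H) \<G> \<and>
    (\<forall>(X, M)\<in>\<G>.
       kgraph k X M \<and>
       asymmetric X M \<and>
       (\<forall>X' M'. sub_kgraph k X' M' X M \<and> 2 \<le> card X' \<and> card X' < card X \<longrightarrow>
          (\<exists>\<phi>. involution \<phi> X' M')))"
proof (intro exI conjI)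
  let ?G = "\<lambda>n. (vertices k n, edges k n)"
  have k: "4 \<le> k" using assms by simp
  \<comment> \<open>The parameter \<open>n\<close> is recovered as the number of edges, so distinct
    parameters give distinct members.\<close>
  have "inj_on ?G {2 * k..}"
  proof (rule inj_onI)
    fix m n assume "m \<in> {2 * k..}" "n \<in> {2 * k..}" "?G m = ?G n"
    then have "edges k m = edges k n" "k \<le> m" "k \<le> n" by auto
    then show "m = n" by (metis card_edges)
  qed
  then show "infinite (?G ` {2 * k..})"
    by (simp add: finite_image_iff infinite_Ici)
  show "pairwise (\<lambda>G H. \<not> isomorphic G H) (?G ` {2 * k..})"
  proof (rule pairwiseI)
    fix G H assume "G \<in> ?G ` {2 * k..}" "H \<in> ?G ` {2 * k..}" "G \<noteq> H"
    then obtain m n where mn: "G = ?G m" "H = ?G n" "2 * k \<le> m" "2 * k \<le> n" "m \<noteq> n"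
      by auto
    have "\<Union> (edges k m) \<subseteq> vertices k m"
      by (auto simp: edges_def edge_def)
    moreover have "card (edges k m) \<noteq> card (edges k n)"
      using mn by (simp add: card_edges)
    ultimately show "\<not> isomorphic G H"
      unfolding mn using isomorphic_card_edges by blast
  qed
  show "\<forall>(X, M)\<in>?G ` {2 * k..}.
       kgraph k X M \<and>
       asymmetric X M \<and>
       (\<forall>X' M'. sub_kgraph k X' M' X M \<and> 2 \<le> card X' \<and> card X' < card X \<longrightarrow>
          (\<exists>\<phi>. involution \<phi> X' M'))"
    using kgraph_vertices_edges[OF k] asymmetric_vertices_edges[OF k] sub_kgraph_involution[OF k]
    by auto
qed

end
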